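(* Let $M$ be a connected Riemannian manifold and let $F$ be a symmetric endomorphism on $TM$ (a tensor field of type $(1,1)$ with $\langle FX,Y\rangle=\langle X,FY\rangle$ for all $X,Y\in TM$). If $F$ is recurrent then $F$ is semi-parallel.
   Context: All objects are smooth. $\nabla$ is the Levi-Civita connection of $M$ and $R$ its curvature tensor. A nonzero tensor field $F$ of type $(1,1)$ on $M$ is recurrent if there exists a $1$-form $\omega$ on $M$ such that $\nabla F=F\otimes\omega$, i.e. $(\nabla_XF)Y=\omega(X)FY$ for all $X,Y\in TM$. $F$ is semi-parallel if $R\cdot F=0$, i.e. $R(X,Y)(FZ)-F(R(X,Y)Z)=0$ for all $X,Y,Z\in TM$. *)

theory Defs
  imports "HOL-Analysis.Analysis" "HOL-Library.Function_Algebras"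
begin

section \<open>Smooth maps between normed spaces\<close>

text \<open>Intended for open \<open>S\<close>. On a finite-dimensional domain, \<open>Ck_on k S f\<close> says that all iterated
  directional derivatives of \<open>f\<close> of order at most \<open>k\<close> exist and are continuous on \<open>S\<close>.\<close>

primrec Ck_on :: "nat \<Rightarrow> 'e set \<Rightarrow> ('e::real_normed_vector \<Rightarrow> 'f::real_normed_vector) \<Rightarrow> bool" where
  "Ck_on 0 S f \<longleftrightarrow> continuous_on S f"
| "Ck_on (Suc k) S f \<longleftrightarrow> (\<forall>x\<in>S. f differentiable (at x)) \<and>
     (\<forall>v. Ck_on k S (\<lambda>x. frechet_derivative f (at x) v))"

definition smooth_on :: "'e set \<Rightarrow> ('e::real_normed_vector \<Rightarrow> 'f::real_normed_vector) \<Rightarrow> bool" where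
  "smooth_on S f \<longleftrightarrow> (\<forall>k. Ck_on k S f)"


section \<open>Smooth manifolds\<close>

text \<open>A chart is a pair of a domain and a coordinate map; the values of the coordinate map outside
  the domain are irrelevant. The smooth structure is given by an atlas, which need not be maximal.\<close>

type_synonym ('a, 'e) chart = "'a set \<times> ('a \<Rightarrow> 'e)"

abbreviation chart_dom :: "('a, 'e) chart \<Rightarrow> 'a set" where
  "chart_dom c \<equiv> fst c"

abbreviation coord :: "('a, 'e) chart \<Rightarrow> 'a \<Rightarrow> 'e" where
  "coord c \<equiv> snd c"

definition chart_image :: "('a, 'e) chart \<Rightarrow> 'e set" where
  "chart_image c = coord c ` chart_dom c"

definition param :: "('a, 'e) chart \<Rightarrow> 'e \<Rightarrow> 'a" where
  "param c = inv_into (chart_dom c) (coord c)"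

definition transition :: "('a, 'e) chart \<Rightarrow> ('a, 'e) chart \<Rightarrow> 'e \<Rightarrow> 'e" where
  "transition c d = coord d \<circ> param c"

definition charts_at :: "('a, 'e) chart set \<Rightarrow> 'a \<Rightarrow> ('a, 'e) chart set" where
  "charts_at A p = {c \<in> A. p \<in> chart_dom c}"

definition smooth_manifold :: "'a topology \<Rightarrow> ('a, 'e::euclidean_space) chart set \<Rightarrow> bool" where
  "smooth_manifold M A \<longleftrightarrow>
     Hausdorff_space M \<and> second_countable M \<and>
     (\<Union>c\<in>A. chart_dom c) = topspace M \<and>
     (\<forall>c\<in>A. openin M (chart_dom c) \<and> open (chart_image c) \<and>
        homeomorphic_map (subtopology M (chart_dom c)) (top_of_set (chart_image c)) (coord c)) \<and>
     (\<forall>c\<in>A. \<forall>d\<in>A. smooth_on (coord c ` (chart_dom c \<inter> chart_dom d)) (transition c d))"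

definition smooth_function :: "('a, 'e::euclidean_space) chart set \<Rightarrow> ('a \<Rightarrow> real) \<Rightarrow> bool" where
  "smooth_function A f \<longleftrightarrow> (\<forall>c\<in>A. smooth_on (chart_image c) (f \<circ> param c))"


section \<open>Tangent vectors and vector fields\<close>

text \<open>A tangent vector at \<open>p\<close> is the family of its coordinate representations in the charts around
  \<open>p\<close>, related by the differentials of the transition maps, and extended by \<open>0\<close> to all
  other pairs. Hence each chart around \<open>p\<close> identifies the tangent space with the model space, and
  the tangent space at a point not covered by the atlas is \<open>{0}\<close>. In particular vector fields are
  automatically \<open>0\<close> outside the manifold, so that equality of vector fields is equality of
  functions. Sums and differences of tangent vectors and of vector fields are the pointwise ones.\<close>

type_synonym ('a, 'e) tvec = "('a, 'e) chart \<Rightarrow> 'e"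

definition tangent_space :: "('a, 'e::euclidean_space) chart set \<Rightarrow> 'a \<Rightarrow> ('a, 'e) tvec set" where
  "tangent_space A p =
     {v. (\<forall>c. c \<notin> charts_at A p \<longrightarrow> v c = 0) \<and>
         (\<forall>c\<in>charts_at A p. \<forall>d\<in>charts_at A p.
            v d = frechet_derivative (transition c d) (at (coord c p)) (v c))}"

definition tscale :: "real \<Rightarrow> ('a, 'e::euclidean_space) tvec \<Rightarrow> ('a, 'e) tvec" where
  "tscale r v = (\<lambda>c. r *\<^sub>R v c)"

text \<open>The tangent vector at \<open>p\<close> whose representation in the chart \<open>c\<close> is \<open>u\<close>; for a basis
  vector \<open>u\<close> this is a coordinate vector field of \<open>c\<close>.\<close>

definition coord_vec ::
    "('a, 'e::euclidean_space) chart set \<Rightarrow> ('a, 'e) chart \<Rightarrow> 'e \<Rightarrow> 'a \<Rightarrow> ('a, 'e) tvec" where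
  "coord_vec A c u p =
     (\<lambda>d. if d \<in> charts_at A p then frechet_derivative (transition c d) (at (coord c p)) u else 0)"

definition vector_field ::
    "('a, 'e::euclidean_space) chart set \<Rightarrow> ('a \<Rightarrow> ('a, 'e) tvec) \<Rightarrow> bool" where
  "vector_field A X \<longleftrightarrow> (\<forall>p. X p \<in> tangent_space A p) \<and>
     (\<forall>c\<in>A. smooth_on (chart_image c) (\<lambda>x. X (param c x) c))"

definition fscale ::
    "('a \<Rightarrow> real) \<Rightarrow> ('a \<Rightarrow> ('a, 'e::euclidean_space) tvec) \<Rightarrow> 'a \<Rightarrow> ('a, 'e) tvec" where
  "fscale f X = (\<lambda>p. tscale (f p) (X p))"

text \<open>The derivative \<open>Xf\<close>; by the chain rule the choice of the chart is immaterial.\<close>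

definition vf_apply ::
    "('a, 'e::euclidean_space) chart set \<Rightarrow> ('a \<Rightarrow> ('a, 'e) tvec) \<Rightarrow> ('a \<Rightarrow> real) \<Rightarrow> 'a \<Rightarrow> real" where
  "vf_apply A X f p =
     (let c = (SOME c. c \<in> charts_at A p)
      in frechet_derivative (f \<circ> param c) (at (coord c p)) (X p c))"

text \<open>In every chart, \<open>[X,Y] = DY(X) - DX(Y)\<close>, i.e. \<open>[X,Y] f = X(Y f) - Y(X f)\<close>.\<close>

definition lie_bracket ::
    "('a, 'e::euclidean_space) chart set \<Rightarrow> ('a \<Rightarrow> ('a, 'e) tvec) \<Rightarrow> ('a \<Rightarrow> ('a, 'e) tvec)
       \<Rightarrow> 'a \<Rightarrow> ('a, 'e) tvec" where
  "lie_bracket A X Y p =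
     (\<lambda>c. if c \<in> charts_at A p
          then frechet_derivative (\<lambda>x. Y (param c x) c) (at (coord c p)) (X p c)
             - frechet_derivative (\<lambda>x. X (param c x) c) (at (coord c p)) (Y p c)
          else 0)"


section \<open>Tensor fields\<close>

text \<open>Smoothness of tensor fields is smoothness of their components in all charts. Only the
  values on tangent vectors matter.\<close>

definition one_form ::
    "('a, 'e::euclidean_space) chart set \<Rightarrow> ('a \<Rightarrow> ('a, 'e) tvec \<Rightarrow> real) \<Rightarrow> bool" where
  "one_form A \<omega> \<longleftrightarrow>
     (\<forall>p. \<forall>u\<in>tangent_space A p. \<forall>v\<in>tangent_space A p. \<omega> p (u + v) = \<omega> p u + \<omega> p v) \<and>
     (\<forall>p. \<forall>u\<in>tangent_space A p. \<forall>r. \<omega> p (tscale r u) = r * \<omega> p u) \<and>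
     (\<forall>c\<in>A. \<forall>u. smooth_on (chart_image c)
        (\<lambda>x. \<omega> (param c x) (coord_vec A c u (param c x))))"

text \<open>Tensor fields of type (1,1).\<close>

definition endomorphism_field ::
    "('a, 'e::euclidean_space) chart set \<Rightarrow> ('a \<Rightarrow> ('a, 'e) tvec \<Rightarrow> ('a, 'e) tvec) \<Rightarrow> bool" where
  "endomorphism_field A F \<longleftrightarrow>
     (\<forall>p. \<forall>u\<in>tangent_space A p. F p u \<in> tangent_space A p) \<and>
     (\<forall>p. \<forall>u\<in>tangent_space A p. \<forall>v\<in>tangent_space A p. F p (u + v) = F p u + F p v) \<and>
     (\<forall>p. \<forall>u\<in>tangent_space A p. \<forall>r. F p (tscale r u) = tscale r (F p u)) \<and>
     (\<forall>c\<in>A. \<forall>u. smooth_on (chart_image c)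
        (\<lambda>x. F (param c x) (coord_vec A c u (param c x)) c))"

definition endo_apply ::
    "('a \<Rightarrow> ('a, 'e) tvec \<Rightarrow> ('a, 'e) tvec) \<Rightarrow> ('a \<Rightarrow> ('a, 'e) tvec) \<Rightarrow> 'a \<Rightarrow> ('a, 'e) tvec" where
  "endo_apply F X = (\<lambda>p. F p (X p))"

definition riemannian_metric ::
    "('a, 'e::euclidean_space) chart set \<Rightarrow> ('a \<Rightarrow> ('a, 'e) tvec \<Rightarrow> ('a, 'e) tvec \<Rightarrow> real) \<Rightarrow> bool" where
  "riemannian_metric A g \<longleftrightarrow>
     (\<forall>p. \<forall>u\<in>tangent_space A p. \<forall>v\<in>tangent_space A p. g p u v = g p v u) \<and>
     (\<forall>p. \<forall>u\<in>tangent_space A p. \<forall>v\<in>tangent_space A p. \<forall>w\<in>tangent_space A p.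
        g p (u + v) w = g p u w + g p v w) \<and>
     (\<forall>p. \<forall>u\<in>tangent_space A p. \<forall>v\<in>tangent_space A p. \<forall>r. g p (tscale r u) v = r * g p u v) \<and>
     (\<forall>p. \<forall>u\<in>tangent_space A p. u \<noteq> 0 \<longrightarrow> g p u u > 0) \<and>
     (\<forall>c\<in>A. \<forall>u v. smooth_on (chart_image c)
        (\<lambda>x. g (param c x) (coord_vec A c u (param c x)) (coord_vec A c v (param c x))))"

definition riemannian_manifold ::
    "'a topology \<Rightarrow> ('a, 'e::euclidean_space) chart set
       \<Rightarrow> ('a \<Rightarrow> ('a, 'e) tvec \<Rightarrow> ('a, 'e) tvec \<Rightarrow> real) \<Rightarrow> bool" where
  "riemannian_manifold M A g \<longleftrightarrow> smooth_manifold M A \<and> riemannian_metric A g"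

definition symmetric_endomorphism ::
    "('a, 'e::euclidean_space) chart set \<Rightarrow> ('a \<Rightarrow> ('a, 'e) tvec \<Rightarrow> ('a, 'e) tvec \<Rightarrow> real)
       \<Rightarrow> ('a \<Rightarrow> ('a, 'e) tvec \<Rightarrow> ('a, 'e) tvec) \<Rightarrow> bool" where
  "symmetric_endomorphism A g F \<longleftrightarrow>
     (\<forall>p. \<forall>u\<in>tangent_space A p. \<forall>v\<in>tangent_space A p. g p (F p u) v = g p u (F p v))"


section \<open>Levi-Civita connection and curvature\<close>

text \<open>Connections act on global smooth vector fields.\<close>

type_synonym ('a, 'e) connection =
  "('a \<Rightarrow> ('a, 'e) tvec) \<Rightarrow> ('a \<Rightarrow> ('a, 'e) tvec) \<Rightarrow> 'a \<Rightarrow> ('a, 'e) tvec"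

definition affine_connection ::
    "('a, 'e::euclidean_space) chart set \<Rightarrow> ('a, 'e) connection \<Rightarrow> bool" where
  "affine_connection A nabla \<longleftrightarrow>
     (\<forall>X Y. vector_field A X \<longrightarrow> vector_field A Y \<longrightarrow> vector_field A (nabla X Y)) \<and>
     (\<forall>X Y Z. vector_field A X \<longrightarrow> vector_field A Y \<longrightarrow> vector_field A Z \<longrightarrow>
        nabla (X + Y) Z = nabla X Z + nabla Y Z \<and>
        nabla X (Y + Z) = nabla X Y + nabla X Z) \<and>
     (\<forall>f X Y. smooth_function A f \<longrightarrow> vector_field A X \<longrightarrow> vector_field A Y \<longrightarrow>
        nabla (fscale f X) Y = fscale f (nabla X Y) \<and>
        nabla X (fscale f Y) = fscale (vf_apply A X f) Y + fscale f (nabla X Y))"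

definition levi_civita ::
    "('a, 'e::euclidean_space) chart set \<Rightarrow> ('a \<Rightarrow> ('a, 'e) tvec \<Rightarrow> ('a, 'e) tvec \<Rightarrow> real)
       \<Rightarrow> ('a, 'e) connection \<Rightarrow> bool" where
  "levi_civita A g nabla \<longleftrightarrow>
     affine_connection A nabla \<and>
     (\<forall>X Y. vector_field A X \<longrightarrow> vector_field A Y \<longrightarrow>
        nabla X Y - nabla Y X = lie_bracket A X Y) \<and>
     (\<forall>X Y Z. vector_field A X \<longrightarrow> vector_field A Y \<longrightarrow> vector_field A Z \<longrightarrow>
        (\<forall>p\<in>(\<Union>c\<in>A. chart_dom c).
           vf_apply A X (\<lambda>q. g q (Y q) (Z q)) p = g p (nabla X Y p) (Z p) + g p (Y p) (nabla X Z p)))"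

definition curvature ::
    "('a, 'e::euclidean_space) chart set \<Rightarrow> ('a, 'e) connection
       \<Rightarrow> ('a \<Rightarrow> ('a, 'e) tvec) \<Rightarrow> ('a \<Rightarrow> ('a, 'e) tvec) \<Rightarrow> ('a \<Rightarrow> ('a, 'e) tvec)
       \<Rightarrow> 'a \<Rightarrow> ('a, 'e) tvec" where
  "curvature A nabla X Y Z =
     nabla X (nabla Y Z) - nabla Y (nabla X Z) - nabla (lie_bracket A X Y) Z"

text \<open>\<open>(\<nabla>\<^sub>X F) Y\<close>\<close>

definition covariant_derivative_endo ::
    "('a, 'e) connection \<Rightarrow> ('a \<Rightarrow> ('a, 'e::euclidean_space) tvec \<Rightarrow> ('a, 'e) tvec)
       \<Rightarrow> ('a \<Rightarrow> ('a, 'e) tvec) \<Rightarrow> ('a \<Rightarrow> ('a, 'e) tvec) \<Rightarrow> 'a \<Rightarrow> ('a, 'e) tvec" where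
  "covariant_derivative_endo nabla F X Y = nabla X (endo_apply F Y) - endo_apply F (nabla X Y)"

text \<open>Nonzero means not identically zero.\<close>

definition recurrent ::
    "('a, 'e::euclidean_space) chart set \<Rightarrow> ('a, 'e) connection
       \<Rightarrow> ('a \<Rightarrow> ('a, 'e) tvec \<Rightarrow> ('a, 'e) tvec) \<Rightarrow> bool" where
  "recurrent A nabla F \<longleftrightarrow>
     (\<exists>p. \<exists>u\<in>tangent_space A p. F p u \<noteq> 0) \<and>
     (\<exists>\<omega>. one_form A \<omega> \<and>
        (\<forall>X Y. vector_field A X \<longrightarrow> vector_field A Y \<longrightarrow>
           covariant_derivative_endo nabla F X Y = fscale (\<lambda>p. \<omega> p (X p)) (endo_apply F Y)))"

definition semi_parallel ::
    "('a, 'e::euclidean_space) chart set \<Rightarrow> ('a, 'e) connection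
       \<Rightarrow> ('a \<Rightarrow> ('a, 'e) tvec \<Rightarrow> ('a, 'e) tvec) \<Rightarrow> bool" where
  "semi_parallel A nabla F \<longleftrightarrow>
     (\<forall>X Y Z. vector_field A X \<longrightarrow> vector_field A Y \<longrightarrow> vector_field A Z \<longrightarrow>
        curvature A nabla X Y (endo_apply F Z) - endo_apply F (curvature A nabla X Y Z) = 0)"

end

theory Submission
  imports Defs
begin

text \<open>Recurrence \<open>\<nabla>F = F \<otimes> \<omega>\<close> gives \<open>[R(X,Y), F] = d\<omega>(X,Y) F\<close>. At a point where \<open>F \<noteq> 0\<close>, the symmetric
  operator \<open>F\<^sup>2\<close> has an eigenvector \<open>w\<close> with eigenvalue \<open>\<mu> > 0\<close>. Pairing the commutator applied to \<open>w\<close>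
  with \<open>F w\<close>, the skew-symmetry of \<open>R(X,Y)\<close> leaves \<open>0 = d\<omega>(X,Y) \<bar>F w\<bar>\<^sup>2 = d\<omega>(X,Y) \<mu> \<bar>w\<bar>\<^sup>2\<close>, so
  \<open>d\<omega>(X,Y) = 0\<close> there.

  As connections act on global vector fields, \<open>w\<close> has to be a value of such a field. No bump functions
  are needed for this: the values at a point of all global fields form an \<open>F\<close>-invariant subspace of
  the tangent space, and the eigenvector is found in that subspace.\<close>

section \<open>Calculus of smooth maps\<close>

lemma frechet_derivative_eqI: "(f has_derivative f') (at x) \<Longrightarrow> frechet_derivative f (at x) = f'"
  using frechet_derivative_at by metis

lemma differentiable_cong_open:
  assumes "open S" "x \<in> S" "\<And>y. y \<in> S \<Longrightarrow> f y = g y" "f differentiable (at x)"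
  shows "g differentiable (at x)" "frechet_derivative g (at x) = frechet_derivative f (at x)"
proof -
  have "(g has_derivative frechet_derivative f (at x)) (at x)"
    using assms has_derivative_transform_within_open[of f _ x UNIV S g]
    by (simp add: frechet_derivative_works)
  then show "g differentiable (at x)" "frechet_derivative g (at x) = frechet_derivative f (at x)"
    by (auto simp: differentiable_def dest: frechet_derivative_at)
qed

text \<open>Derivatives at points of an open set see only the values on that set, so the induction
  can pass to the derivatives. Through this, coordinate expressions are replaced by ones that agree
  only on a chart image, outside of which \<open>param\<close> is arbitrary.\<close>

lemma Ck_on_cong:
  assumes "open S" "\<And>y. y \<in> S \<Longrightarrow> f y = g y" "Ck_on k S f"
  shows "Ck_on k S g"
  using assms(2,3)
proof (induction k arbitrary: f g)
  case 0
  then show ?case using continuous_on_cong[of S S f g] by simp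
next
  case (Suc k)
  have d: "g differentiable (at x)" "frechet_derivative g (at x) = frechet_derivative f (at x)"
    if "x \<in> S" for x
    using differentiable_cong_open[OF assms(1) that, of f g] Suc.prems that by auto
  have "Ck_on k S (\<lambda>x. frechet_derivative g (at x) v)" for v
    by (rule Suc.IH[of "\<lambda>x. frechet_derivative f (at x) v"]) (use Suc.prems d in auto)
  then show ?case using d by simp
qed

lemma Ck_on_Suc_imp:
  "Ck_on (Suc k) S f \<Longrightarrow> Ck_on k S f"
proof (induction k arbitrary: f)
  case 0
  then show ?case
    by (auto intro!: continuous_at_imp_continuous_on differentiable_imp_continuous_within)
next
  case (Suc k)
  then show ?case by (metis Ck_on.simps(2))
qed

lemma Ck_on_const: "Ck_on k S (\<lambda>x. c)"
proof (induction k arbitrary: c)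
  case (Suc k)
  then show ?case by simp
qed simp

text \<open>The derivative of the composite is again \<open>L\<close> applied to a map, now of class
  \<open>k\<close>, so the induction closes on maps of the same shape.\<close>

lemma Ck_on_bounded_linear:
  assumes "bounded_linear L" "open S"
  shows "Ck_on k S f \<Longrightarrow> Ck_on k S (\<lambda>x. L (f x))"
proof (induction k arbitrary: f)
  case 0
  then show ?case
    by (simp add: bounded_linear.continuous_on[OF assms(1)])
next
  case (Suc k)
  have h: "((\<lambda>x. L (f x)) has_derivative (\<lambda>v. L (frechet_derivative f (at x) v))) (at x)"
    if "x \<in> S" for x
    using Suc.prems that
    by (intro bounded_linear.has_derivative[OF assms(1)]) (simp add: frechet_derivative_works[symmetric])
  have "Ck_on k S (\<lambda>x. frechet_derivative (\<lambda>x. L (f x)) (at x) v)" for v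
    by (rule Ck_on_cong[OF assms(2) _ Suc.IH[of "\<lambda>x. frechet_derivative f (at x) v"]])
      (use Suc.prems in \<open>auto simp: frechet_derivative_eqI[OF h]\<close>)
  then show ?case using h by (auto simp: differentiable_def)
qed

lemma Ck_on_add:
  assumes "open S"
  shows "Ck_on k S f \<Longrightarrow> Ck_on k S g \<Longrightarrow> Ck_on k S (\<lambda>x. f x + g x)"
proof (induction k arbitrary: f g)
  case 0
  then show ?case by (simp add: continuous_on_add)
next
  case (Suc k)
  have h: "((\<lambda>x. f x + g x) has_derivative
      (\<lambda>v. frechet_derivative f (at x) v + frechet_derivative g (at x) v)) (at x)"
    if "x \<in> S" for x
    using Suc.prems that
    by (intro has_derivative_add) (simp_all add: frechet_derivative_works[symmetric])
  have "Ck_on k S (\<lambda>x. frechet_derivative (\<lambda>x. f x + g x) (at x) v)" for v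
    by (rule Ck_on_cong[OF assms _ Suc.IH[of "\<lambda>x. frechet_derivative f (at x) v"
            "\<lambda>x. frechet_derivative g (at x) v"]])
      (use Suc.prems in \<open>auto simp: frechet_derivative_eqI[OF h]\<close>)
  then show ?case using h by (auto simp: differentiable_def)
qed

text \<open>The product rule brings back \<open>f\<close> and \<open>g\<close> undifferentiated;
  \<open>Ck_on_Suc_imp\<close> lowers their order to the one at which the induction hypothesis
  applies.\<close>

lemma Ck_on_scaleR:
  assumes "open S"
  shows "Ck_on k S f \<Longrightarrow> Ck_on k S g \<Longrightarrow> Ck_on k S (\<lambda>x. f x *\<^sub>R g x)"
proof (induction k arbitrary: f g)
  case 0
  then show ?case by (simp add: continuous_on_scaleR)
next
  case (Suc k)
  have h: "((\<lambda>x. f x *\<^sub>R g x) has_derivative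
      (\<lambda>v. f x *\<^sub>R frechet_derivative g (at x) v + frechet_derivative f (at x) v *\<^sub>R g x)) (at x)"
    if "x \<in> S" for x
    using Suc.prems that
    by (intro has_derivative_scaleR) (simp_all add: frechet_derivative_works[symmetric])
  have "Ck_on k S (\<lambda>x. frechet_derivative (\<lambda>x. f x *\<^sub>R g x) (at x) v)" for v
  proof (rule Ck_on_cong[OF assms])
    show "Ck_on k S (\<lambda>x. f x *\<^sub>R frechet_derivative g (at x) v + frechet_derivative f (at x) v *\<^sub>R g x)"
      using Suc.prems
      by (intro Ck_on_add[OF assms] Suc.IH Ck_on_Suc_imp[of k S f] Ck_on_Suc_imp[of k S g]) auto
  qed (auto simp: frechet_derivative_eqI[OF h])
  then show ?case using h by (auto simp: differentiable_def)
qed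

section \<open>Closure properties of smooth maps\<close>

lemma smooth_on_cong:
  "open S \<Longrightarrow> (\<And>y. y \<in> S \<Longrightarrow> f y = g y) \<Longrightarrow> smooth_on S f \<Longrightarrow> smooth_on S g"
  unfolding smooth_on_def using Ck_on_cong by blast

lemma smooth_on_const: "smooth_on S (\<lambda>x. c)"
  by (simp add: smooth_on_def Ck_on_const)

lemma smooth_on_bounded_linear:
  "bounded_linear L \<Longrightarrow> open S \<Longrightarrow> smooth_on S f \<Longrightarrow> smooth_on S (\<lambda>x. L (f x))"
  by (simp add: smooth_on_def Ck_on_bounded_linear)

lemma smooth_on_add:
  "open S \<Longrightarrow> smooth_on S f \<Longrightarrow> smooth_on S g \<Longrightarrow> smooth_on S (\<lambda>x. f x + g x)"
  by (simp add: smooth_on_def Ck_on_add)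

lemma smooth_on_scaleR:
  "open S \<Longrightarrow> smooth_on S f \<Longrightarrow> smooth_on S g \<Longrightarrow> smooth_on S (\<lambda>x. f x *\<^sub>R g x)"
  by (simp add: smooth_on_def Ck_on_scaleR)

lemma smooth_on_diff:
  assumes "open S" "smooth_on S f" "smooth_on S g"
  shows "smooth_on S (\<lambda>x. f x - g x)"
  using smooth_on_add[OF assms(1,2) smooth_on_scaleR[OF assms(1) smooth_on_const[of S "-1"] assms(3)]]
  by simp

lemma smooth_on_sum:
  assumes "open S" "\<And>i. i \<in> I \<Longrightarrow> smooth_on S (f i)"
  shows "smooth_on S (\<lambda>x. \<Sum>i\<in>I. f i x)"
  using assms(2)
  by (induction I rule: infinite_finite_induct) (simp_all add: smooth_on_const smooth_on_add[OF assms(1)])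

lemma smooth_on_differentiable:
  "smooth_on S f \<Longrightarrow> x \<in> S \<Longrightarrow> f differentiable (at x)"
  unfolding smooth_on_def using Ck_on.simps(2) by blast

lemma smooth_on_has_derivative:
  "smooth_on S f \<Longrightarrow> x \<in> S \<Longrightarrow> (f has_derivative frechet_derivative f (at x)) (at x)"
  by (simp add: frechet_derivative_works[symmetric] smooth_on_differentiable)

lemma smooth_on_frechet_derivative:
  "smooth_on S f \<Longrightarrow> smooth_on S (\<lambda>x. frechet_derivative f (at x) v)"
  unfolding smooth_on_def using Ck_on.simps(2) by blast

lemma smooth_on_continuous: "smooth_on S f \<Longrightarrow> continuous_on S f"
  unfolding smooth_on_def using Ck_on.simps(1) by blast

section \<open>Symmetry of second derivatives\<close>

lemma has_real_derivative_along_line: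
  fixes f :: "'e::real_normed_vector \<Rightarrow> real"
  assumes "f differentiable (at (a + s *\<^sub>R v))"
  shows "((\<lambda>s. f (a + s *\<^sub>R v)) has_real_derivative frechet_derivative f (at (a + s *\<^sub>R v)) v) (at s)"
proof -
  let ?D = "frechet_derivative f (at (a + s *\<^sub>R v))"
  have f: "(f has_derivative ?D) (at (a + s *\<^sub>R v))"
    using assms by (simp add: frechet_derivative_works)
  have "((\<lambda>s. f (a + s *\<^sub>R v)) has_derivative (\<lambda>h. ?D (h *\<^sub>R v))) (at s)"
    by (rule has_derivative_compose[where f = "\<lambda>s. a + s *\<^sub>R v", OF _ f])
      (auto intro!: derivative_eq_intros)
  then show ?thesis
    using has_derivative_linear[OF f]
    by (simp add: has_field_derivative_def linear_cmul mult.commute[of _ "?D v"] ext)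
qed

text \<open>The second difference is the increment of \<open>?G\<close> over [0,t]. The mean value
  theorem in direction \<open>v\<close> turns it into a difference of first derivatives, and a
  second application in direction \<open>w\<close> produces the mixed derivative.\<close>

lemma second_difference_mean_value:
  fixes f :: "'e::real_normed_vector \<Rightarrow> real"
  assumes f: "smooth_on S f" and "t > 0"
    and S: "\<And>r s. 0 \<le> r \<Longrightarrow> r \<le> t \<Longrightarrow> 0 \<le> s \<Longrightarrow> s \<le> t \<Longrightarrow> x + r *\<^sub>R v + s *\<^sub>R w \<in> S"
  obtains r s where "0 < r" "r < t" "0 < s" "s < t"
    "f (x + t *\<^sub>R v + t *\<^sub>R w) - f (x + t *\<^sub>R v) - f (x + t *\<^sub>R w) + f x
       = t * t * frechet_derivative (\<lambda>y. frechet_derivative f (at y) v) (at (x + r *\<^sub>R v + s *\<^sub>R w)) w"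
proof -
  let ?Dv = "\<lambda>y. frechet_derivative f (at y) v"
  let ?G = "\<lambda>r. f ((x + t *\<^sub>R w) + r *\<^sub>R v) - f (x + r *\<^sub>R v)"
  have S0: "x + r *\<^sub>R v \<in> S" and S1: "(x + t *\<^sub>R w) + r *\<^sub>R v \<in> S" if "0 \<le> r" "r \<le> t" for r
    using S[of r 0] S[of r t] that \<open>t > 0\<close> by (simp_all add: algebra_simps)
  have "(?G has_real_derivative ?Dv ((x + t *\<^sub>R w) + r *\<^sub>R v) - ?Dv (x + r *\<^sub>R v)) (at r)"
    if "0 \<le> r" "r \<le> t" for r
    using S0[OF that] S1[OF that]
    by (intro DERIV_diff has_real_derivative_along_line smooth_on_differentiable[OF f])
  from MVT2[OF \<open>t > 0\<close> this] obtain r where r: "0 < r" "r < t"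
    and 1: "?G t - ?G 0 = t * (?Dv ((x + t *\<^sub>R w) + r *\<^sub>R v) - ?Dv (x + r *\<^sub>R v))" by auto
  have "((\<lambda>s. ?Dv ((x + r *\<^sub>R v) + s *\<^sub>R w)) has_real_derivative
      frechet_derivative ?Dv (at ((x + r *\<^sub>R v) + s *\<^sub>R w)) w) (at s)" if "0 \<le> s" "s \<le> t" for s
    using S[of r s] that r
    by (intro has_real_derivative_along_line
        smooth_on_differentiable[OF smooth_on_frechet_derivative[OF f]]) auto
  from MVT2[OF \<open>t > 0\<close> this] obtain s where s: "0 < s" "s < t"
    and 2: "?Dv ((x + r *\<^sub>R v) + t *\<^sub>R w) - ?Dv (x + r *\<^sub>R v)
        = t * frechet_derivative ?Dv (at ((x + r *\<^sub>R v) + s *\<^sub>R w)) w" by auto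
  have "?G t - ?G 0 = t * t * frechet_derivative ?Dv (at (x + r *\<^sub>R v + s *\<^sub>R w)) w"
    unfolding 1 mult.assoc 2[symmetric] by (simp add: add_ac)
  then show ?thesis using that[OF r s] by (simp add: algebra_simps)
qed

text \<open>The second difference does not change when \<open>v\<close> and \<open>w\<close> are
  exchanged. It therefore equates values of the two mixed derivatives at two points of one small
  parallelogram, and continuity of both carries the equality to \<open>x\<close>.\<close>

lemma smooth_on_second_derivative_symmetric:
  fixes f :: "'e::real_normed_vector \<Rightarrow> real"
  assumes f: "smooth_on S f" and S: "open S" "x \<in> S"
  shows "frechet_derivative (\<lambda>y. frechet_derivative f (at y) v) (at x) w
       = frechet_derivative (\<lambda>y. frechet_derivative f (at y) w) (at x) v"
proof -
  define H where "H v w y = frechet_derivative (\<lambda>y. frechet_derivative f (at y) v) (at y) w" for v w y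
  have cont: "isCont (H v w) x" for v w
    using smooth_on_continuous[OF smooth_on_frechet_derivative[OF smooth_on_frechet_derivative[OF f]]] S
    unfolding H_def by (simp add: continuous_on_eq_continuous_at)
  have "\<bar>H v w x - H w v x\<bar> \<le> e" if "e > 0" for e
  proof -
    from cont[of v w] cont[of w v] \<open>e > 0\<close> obtain d1 d2 where d: "d1 > 0" "d2 > 0"
      and d1: "\<And>y. dist y x < d1 \<Longrightarrow> \<bar>H v w y - H v w x\<bar> < e / 2"
      and d2: "\<And>y. dist y x < d2 \<Longrightarrow> \<bar>H w v y - H w v x\<bar> < e / 2"
      unfolding continuous_at_eps_delta dist_real_def by (metis half_gt_zero)
    obtain d3 where d3: "d3 > 0" "ball x d3 \<subseteq> S"
      using S openE by blast
    define d where "d = min d1 (min d2 d3)"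
    \<comment> \<open>This size keeps the whole parallelogram spanned by
      \<open>t *\<^sub>R v\<close> and \<open>t *\<^sub>R w\<close> within distance \<open>d\<close>
      of \<open>x\<close>; the summand 1 keeps the denominator positive when \<open>v\<close> and
      \<open>w\<close> both vanish.\<close>
    define t where "t = d / (norm v + norm w + 1)"
    have pos: "norm v + norm w + 1 > 0" by (simp add: add_nonneg_pos)
    have "d > 0" using d d3 by (simp add: d_def)
    then have "t > 0" using pos by (simp add: t_def)
    have near: "dist (x + r *\<^sub>R v + s *\<^sub>R w) x < d" if "0 \<le> r" "r \<le> t" "0 \<le> s" "s \<le> t" for r s
    proof -
      have "dist (x + r *\<^sub>R v + s *\<^sub>R w) x \<le> r * norm v + s * norm w"
        using norm_triangle_ineq[of "r *\<^sub>R v" "s *\<^sub>R w"] that by (simp add: dist_norm add.assoc)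
      also have "\<dots> \<le> t * norm v + t * norm w"
        using that by (intro add_mono mult_right_mono) auto
      also have "\<dots> < t * (norm v + norm w + 1)"
        using \<open>t > 0\<close> by (simp add: algebra_simps)
      also have "\<dots> = d" using pos by (simp add: t_def)
      finally show ?thesis .
    qed
    have inS: "x + r *\<^sub>R v + s *\<^sub>R w \<in> S" if "0 \<le> r" "r \<le> t" "0 \<le> s" "s \<le> t" for r s
      using near[OF that] d3(2) by (auto simp: d_def dist_commute)
    have inS': "x + r *\<^sub>R w + s *\<^sub>R v \<in> S" if "0 \<le> r" "r \<le> t" "0 \<le> s" "s \<le> t" for r s
      using inS[OF that(3,4,1,2)] by (simp add: add_ac)
    from second_difference_mean_value[OF f \<open>t > 0\<close> inS] obtain r s
      where rs: "0 < r" "r < t" "0 < s" "s < t" and 1: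
        "f (x + t *\<^sub>R v + t *\<^sub>R w) - f (x + t *\<^sub>R v) - f (x + t *\<^sub>R w) + f x
         = t * t * H v w (x + r *\<^sub>R v + s *\<^sub>R w)"
      unfolding H_def by blast
    from second_difference_mean_value[OF f \<open>t > 0\<close> inS'] obtain r' s'
      where rs': "0 < r'" "r' < t" "0 < s'" "s' < t" and 2:
        "f (x + t *\<^sub>R w + t *\<^sub>R v) - f (x + t *\<^sub>R w) - f (x + t *\<^sub>R v) + f x
         = t * t * H w v (x + r' *\<^sub>R w + s' *\<^sub>R v)"
      unfolding H_def by blast
    have "H v w (x + r *\<^sub>R v + s *\<^sub>R w) = H w v (x + r' *\<^sub>R w + s' *\<^sub>R v)"
    proof -
      have eq: "x + t *\<^sub>R w + t *\<^sub>R v = x + t *\<^sub>R v + t *\<^sub>R w" by (simp add: add_ac)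
      from 1 2[unfolded eq]
      have "t * t * H v w (x + r *\<^sub>R v + s *\<^sub>R w) = t * t * H w v (x + r' *\<^sub>R w + s' *\<^sub>R v)"
        by linarith
      then show ?thesis using \<open>t > 0\<close> by simp
    qed
    moreover have "\<bar>H v w (x + r *\<^sub>R v + s *\<^sub>R w) - H v w x\<bar> < e / 2"
      using near[of r s] rs by (intro d1) (simp add: d_def)
    moreover have "\<bar>H w v (x + r' *\<^sub>R w + s' *\<^sub>R v) - H w v x\<bar> < e / 2"
      using near[of s' r'] rs' by (intro d2) (simp add: d_def add_ac)
    ultimately show ?thesis by linarith
  qed
  then have "\<bar>H v w x - H w v x\<bar> \<le> 0" by (rule field_le_epsilon[of _ 0, simplified])
  then show ?thesis by (simp add: H_def)
qed

text \<open>Expanding \<open>z y\<close> in the basis writes the map as a finite sum of products of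
  smooth maps. Smoothness of tensor fields is defined on constant arguments \<open>u\<close>; this
  extends it to arguments that vary with the point.\<close>

lemma linear_family_smooth:
  fixes L :: "'e::real_normed_vector \<Rightarrow> 'f::euclidean_space \<Rightarrow> 'g::real_normed_vector"
  assumes S: "open S" and lin: "\<And>y. y \<in> S \<Longrightarrow> linear (L y)"
    and L: "\<And>u. smooth_on S (\<lambda>y. L y u)" and z: "smooth_on S z"
  shows "smooth_on S (\<lambda>y. L y (z y))"
proof (rule smooth_on_cong[OF S])
  show "smooth_on S (\<lambda>y. \<Sum>b\<in>Basis. (z y \<bullet> b) *\<^sub>R L y b)"
    by (intro smooth_on_sum smooth_on_scaleR S L z
        smooth_on_bounded_linear[of "\<lambda>v. v \<bullet> _"] bounded_linear_inner_left)
  show "(\<Sum>b\<in>Basis. (z y \<bullet> b) *\<^sub>R L y b) = L y (z y)" if "y \<in> S" for y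
  proof -
    have "L y (z y) = L y (\<Sum>b\<in>Basis. (z y \<bullet> b) *\<^sub>R b)" by (simp add: euclidean_representation)
    also have "\<dots> = (\<Sum>b\<in>Basis. (z y \<bullet> b) *\<^sub>R L y b)"
      by (simp add: linear_sum[OF lin[OF that]] linear_cmul[OF lin[OF that]])
    finally show ?thesis by simp
  qed
qed

text \<open>This is the product rule for evaluation: differentiate \<open>L\<close> with the
  argument frozen at \<open>z x\<close>, then differentiate the argument with \<open>L x\<close>
  frozen. It follows from the ordinary product rule after expansion in the basis.\<close>

lemma linear_family_has_derivative:
  fixes L :: "'e::real_normed_vector \<Rightarrow> 'f::euclidean_space \<Rightarrow> 'g::real_normed_vector"
  assumes S: "open S" "x \<in> S" and lin: "\<And>y. y \<in> S \<Longrightarrow> linear (L y)"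
    and L: "\<And>u. (\<lambda>y. L y u) differentiable (at x)" and z: "(z has_derivative z') (at x)"
  shows "((\<lambda>y. L y (z y)) has_derivative
      (\<lambda>v. frechet_derivative (\<lambda>y. L y (z x)) (at x) v + L x (z' v))) (at x)"
proof -
  let ?D = "\<lambda>b. frechet_derivative (\<lambda>y. L y b) (at x)"
  have expand: "L y u = (\<Sum>b\<in>Basis. (u \<bullet> b) *\<^sub>R L y b)" if "y \<in> S" for y u
  proof -
    have "L y u = L y (\<Sum>b\<in>Basis. (u \<bullet> b) *\<^sub>R b)" by (simp add: euclidean_representation)
    also have "\<dots> = (\<Sum>b\<in>Basis. (u \<bullet> b) *\<^sub>R L y b)"
      by (simp add: linear_sum[OF lin[OF that]] linear_cmul[OF lin[OF that]])
    finally show ?thesis .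
  qed
  have D: "((\<lambda>y. L y b) has_derivative ?D b) (at x)" for b
    using L by (simp add: frechet_derivative_works)
  have "((\<lambda>y. \<Sum>b\<in>Basis. (z x \<bullet> b) *\<^sub>R L y b) has_derivative (\<lambda>v. \<Sum>b\<in>Basis. (z x \<bullet> b) *\<^sub>R ?D b v)) (at x)"
    by (intro has_derivative_sum has_derivative_scaleR_right D)
  then have "((\<lambda>y. L y (z x)) has_derivative (\<lambda>v. \<Sum>b\<in>Basis. (z x \<bullet> b) *\<^sub>R ?D b v)) (at x)"
    by (rule has_derivative_transform_within_open[OF _ S]) (simp add: expand[of _ "z x"])
  then have 1: "?D (z x) v = (\<Sum>b\<in>Basis. (z x \<bullet> b) *\<^sub>R ?D b v)" for v
    by (simp add: frechet_derivative_eqI)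
  have "((\<lambda>y. \<Sum>b\<in>Basis. (z y \<bullet> b) *\<^sub>R L y b) has_derivative
      (\<lambda>v. \<Sum>b\<in>Basis. (z x \<bullet> b) *\<^sub>R ?D b v + (z' v \<bullet> b) *\<^sub>R L x b)) (at x)"
    by (intro has_derivative_sum has_derivative_scaleR D has_derivative_inner_left z)
  then have "((\<lambda>y. \<Sum>b\<in>Basis. (z y \<bullet> b) *\<^sub>R L y b) has_derivative (\<lambda>v. ?D (z x) v + L x (z' v))) (at x)"
    by (simp add: sum.distrib 1[symmetric] expand[OF S(2), symmetric])
  then show ?thesis
    by (rule has_derivative_transform_within_open[OF _ S]) (simp add: expand[symmetric])
qed

section \<open>Self-adjoint endomorphisms\<close>

text \<open>The Rayleigh quotient \<open>q\<close> of the square of \<open>B\<close> attains its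
  maximum \<mu> on the compact unit sphere of \<open>V\<close>, and a maximiser is an eigenvector of
  that square. Squaring makes \<mu> positive as soon as \<open>B\<close> is nonzero somewhere on
  \<open>V\<close>.\<close>

lemma self_adjoint_square_eigenvector:
  fixes b :: "'e::euclidean_space \<Rightarrow> 'e \<Rightarrow> real"
  assumes b: "bilinear b" and sym: "\<And>u v. b u v = b v u" and pos: "\<And>u. u \<noteq> 0 \<Longrightarrow> b u u > 0"
    and B: "linear B" and adj: "\<And>u v. b (B u) v = b u (B v)"
    and V: "subspace V" and BV: "\<And>u. u \<in> V \<Longrightarrow> B u \<in> V" and u: "u \<in> V" "B u \<noteq> 0"
  obtains z \<mu> where "z \<in> V" "z \<noteq> 0" "\<mu> > 0" "B (B z) = \<mu> *\<^sub>R z"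
proof -
  note bsimps = bilinear_ladd[OF b] bilinear_radd[OF b] bilinear_lmul[OF b] bilinear_rmul[OF b]
    bilinear_lsub[OF b] bilinear_rsub[OF b] bilinear_lzero[OF b] bilinear_rzero[OF b]
    linear_add[OF B] linear_cmul[OF B] linear_0[OF B]
  define q where "q u = b (B u) (B u) / b u u" for u
  \<comment> \<open>The sphere is that of the Euclidean norm rather than of \<open>b\<close>; since
    \<open>q\<close> is homogeneous of degree 0, its maximum there bounds it on all nonzero vectors
    of \<open>V\<close>.\<close>
  let ?K = "V \<inter> sphere 0 1"
  have "u \<noteq> 0" using u linear_0[OF B] by auto
  have normalize: "(1 / norm w) *\<^sub>R w \<in> ?K" if "w \<in> V" "w \<noteq> 0" for w
    using that subspace_scale[OF V] by simp
  have "compact ?K"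
    using closed_subspace[OF V] by (simp add: closed_Int_compact)
  moreover have "?K \<noteq> {}" using normalize[OF u(1) \<open>u \<noteq> 0\<close>] by blast
  moreover have "continuous_on ?K q"
  proof -
    have "b w w \<noteq> 0" if "w \<in> ?K" for w using pos[of w] that by fastforce
    then show ?thesis
      unfolding q_def
      by (intro continuous_on_divide bilinear_continuous_on_compose[OF _ _ b]
          linear_continuous_on_compose[OF _ B] continuous_on_id') auto
  qed
  ultimately obtain z where z: "z \<in> ?K" and max: "\<And>w. w \<in> ?K \<Longrightarrow> q w \<le> q z"
    using continuous_attains_sup[of ?K q] by blast
  define \<mu> where "\<mu> = q z"
  have "z \<noteq> 0" using z by auto
  have le: "b (B w) (B w) \<le> \<mu> * b w w" if "w \<in> V" for w
  proof (cases "w = 0")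
    case False
    have "q w = q ((1 / norm w) *\<^sub>R w)" using False by (simp add: q_def bsimps)
    then have "q w \<le> \<mu>" using max[OF normalize[OF that False]] by (simp add: \<mu>_def)
    then show ?thesis using pos[OF False] by (simp add: q_def pos_divide_le_eq)
  qed (simp add: bsimps)
  \<comment> \<open>The vector \<open>u\<close> with \<open>B u\<close> nonzero already has a
    positive quotient, and \<mu> is the maximum.\<close>
  have "0 < \<mu> * b u u" using le[OF u(1)] pos[OF u(2)] by linarith
  then have "\<mu> > 0" using pos[OF \<open>u \<noteq> 0\<close>] by (simp add: zero_less_mult_iff)
  define w where "w = \<mu> *\<^sub>R z - B (B z)"
  have wV: "w \<in> V" using z BV V by (auto simp: w_def intro!: subspace_diff subspace_scale)
  \<comment> \<open>\<open>\<mu> b(v,v) - b(Bv,Bv)\<close> is nonnegative on \<open>V\<close> and vanishes at \<open>z\<close>, so its differential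
    \<open>2 b(w, -)\<close> at \<open>z\<close> vanishes on \<open>V\<close>.\<close>
  define a where "a = b w w"
  define k where "k = \<mu> * b w w - b (B w) (B w)"
  have zz: "\<mu> * b z z = b (B z) (B z)"
    using pos[OF \<open>z \<noteq> 0\<close>] by (simp add: \<mu>_def q_def)
  have a: "a = \<mu> * b z w - b (B z) (B w)"
    unfolding a_def by (subst (1) w_def) (simp add: bsimps adj)
  have quad: "0 \<le> 2 * t * a + t * t * k" for t
  proof -
    have "z + t *\<^sub>R w \<in> V" using z wV V by (auto intro!: subspace_add subspace_scale)
    from le[OF this] have "0 \<le> \<mu> * b (z + t *\<^sub>R w) (z + t *\<^sub>R w) - b (B (z + t *\<^sub>R w)) (B (z + t *\<^sub>R w))"
      by simp
    also have "\<dots> = 2 * t * a + t * t * k"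
      using zz unfolding a k_def
      by (simp add: bsimps sym[of w z] sym[of "B w" "B z"] algebra_simps)
    finally show ?thesis .
  qed
  have "k \<ge> 0" using le[OF wV] by (simp add: k_def)
  have "a = 0"
  proof -
    \<comment> \<open>The quadratic in \<open>quad\<close> is tested at t = -a/(k+1), where it is
      negative unless a = 0; k+1 instead of k also covers k = 0.\<close>
    have "2 * (- a / (k + 1)) * a + (- a / (k + 1)) * (- a / (k + 1)) * k
        = - (a * a) * ((k + 2) / ((k + 1) * (k + 1)))"
      using \<open>k \<ge> 0\<close> by (simp add: divide_simps) (simp add: algebra_simps)
    then have "a * a * ((k + 2) / ((k + 1) * (k + 1))) \<le> 0"
      using quad[of "- a / (k + 1)"] by simp
    moreover have "(k + 2) / ((k + 1) * (k + 1)) > 0" using \<open>k \<ge> 0\<close> by simp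
    ultimately have "a * a \<le> 0" by (meson mult_pos_pos not_le)
    then show ?thesis by (auto simp: mult_le_0_iff)
  qed
  then have "w = 0" using pos[of w] by (auto simp: a_def)
  then show ?thesis using that[of z \<mu>] z \<open>z \<noteq> 0\<close> \<open>\<mu> > 0\<close> by (simp add: w_def)
qed

section \<open>Charts and tangent vectors\<close>

locale atlas =
  fixes M :: "'a topology" and A :: "('a, 'e::euclidean_space) chart set"
  assumes manifold: "smooth_manifold M A"
begin

lemma open_chart_image: "c \<in> A \<Longrightarrow> open (chart_image c)"
  using manifold unfolding smooth_manifold_def by blast

lemma chart_homeomorphic:
  "c \<in> A \<Longrightarrow> homeomorphic_map (subtopology M (chart_dom c)) (top_of_set (chart_image c)) (coord c)"
  using manifold unfolding smooth_manifold_def by blast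

lemma chart_dom_openin: "c \<in> A \<Longrightarrow> openin M (chart_dom c)"
  using manifold unfolding smooth_manifold_def by blast

lemma coord_inj: "c \<in> A \<Longrightarrow> inj_on (coord c) (chart_dom c)"
  using homeomorphic_imp_injective_map[OF chart_homeomorphic[of c]]
    openin_subset[OF chart_dom_openin[of c]]
  by (simp add: Int_absorb1)

lemma param_coord: "c \<in> A \<Longrightarrow> p \<in> chart_dom c \<Longrightarrow> param c (coord c p) = p"
  by (simp add: param_def coord_inj)

lemma param_in_dom: "y \<in> chart_image c \<Longrightarrow> param c y \<in> chart_dom c"
  by (simp add: param_def chart_image_def inv_into_into)

lemma coord_param: "y \<in> chart_image c \<Longrightarrow> coord c (param c y) = y"
  by (simp add: param_def chart_image_def f_inv_into_f)

lemma coord_in_image: "p \<in> chart_dom c \<Longrightarrow> coord c p \<in> chart_image c"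
  by (simp add: chart_image_def)

lemma charts_at_iff: "c \<in> charts_at A p \<longleftrightarrow> c \<in> A \<and> p \<in> chart_dom c"
  by (simp add: charts_at_def)

lemma param_charts_at: "c \<in> A \<Longrightarrow> y \<in> chart_image c \<Longrightarrow> c \<in> charts_at A (param c y)"
  by (simp add: charts_at_iff param_in_dom)

text \<open>A chart is an open map onto an open subset of the model space. Openness of the overlap
  is what the chain rule for changes of chart requires.\<close>

lemma open_overlap:
  assumes "c \<in> A" "d \<in> A"
  shows "open (coord c ` (chart_dom c \<inter> chart_dom d))"
proof -
  have "openin (subtopology M (chart_dom c)) (chart_dom c \<inter> chart_dom d)"
    using chart_dom_openin[OF assms(2)] by (auto simp: openin_subtopology Int_commute)
  then have "openin (top_of_set (chart_image c)) (coord c ` (chart_dom c \<inter> chart_dom d))"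
    using homeomorphic_imp_open_map[OF chart_homeomorphic[OF assms(1)]] by (simp add: open_map_def)
  then show ?thesis using open_chart_image[OF assms(1)] openin_open_trans by blast
qed

section \<open>Transition maps and the chain rule\<close>

lemma transition_has_derivative:
  assumes "c \<in> charts_at A p" "d \<in> charts_at A p"
  shows "(transition c d has_derivative frechet_derivative (transition c d) (at (coord c p))) (at (coord c p))"
proof -
  have "smooth_on (coord c ` (chart_dom c \<inter> chart_dom d)) (transition c d)"
    using manifold assms unfolding smooth_manifold_def charts_at_iff by blast
  then show ?thesis
    using assms by (auto intro!: smooth_on_has_derivative simp: charts_at_iff)
qed

lemma transition_coord:
  "c \<in> charts_at A p \<Longrightarrow> transition c d (coord c p) = coord d p"
  by (simp add: transition_def charts_at_iff param_coord)

lemma has_derivative_change_chart: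
  assumes cd: "c \<in> charts_at A p" "d \<in> charts_at A p"
    and h: "((h \<circ> param d) has_derivative h') (at (coord d p))"
  shows "((h \<circ> param c) has_derivative
      (\<lambda>u. h' (frechet_derivative (transition c d) (at (coord c p)) u))) (at (coord c p))"
proof (rule has_derivative_transform_within_open)
  show "((\<lambda>y. (h \<circ> param d) (transition c d y)) has_derivative
      (\<lambda>u. h' (frechet_derivative (transition c d) (at (coord c p)) u))) (at (coord c p))"
    using has_derivative_compose[OF transition_has_derivative[OF cd], of "h \<circ> param d" h'] h
    by (simp add: transition_coord[OF cd(1)])
  show "open (coord c ` (chart_dom c \<inter> chart_dom d))"
    using open_overlap cd by (simp add: charts_at_iff)
  show "coord c p \<in> coord c ` (chart_dom c \<inter> chart_dom d)"
    using cd by (simp add: charts_at_iff)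
  show "(h \<circ> param d) (transition c d y) = (h \<circ> param c) y"
    if "y \<in> coord c ` (chart_dom c \<inter> chart_dom d)" for y
    using that cd by (auto simp: transition_def charts_at_iff param_coord)
qed

lemma frechet_derivative_change_chart:
  assumes cd: "c \<in> charts_at A p" "d \<in> charts_at A p"
    and h: "(h \<circ> param d) differentiable (at (coord d p))"
  shows "frechet_derivative (h \<circ> param c) (at (coord c p)) u
    = frechet_derivative (h \<circ> param d) (at (coord d p))
        (frechet_derivative (transition c d) (at (coord c p)) u)"
proof -
  have "((h \<circ> param d) has_derivative frechet_derivative (h \<circ> param d) (at (coord d p))) (at (coord d p))"
    using h by (simp add: frechet_derivative_works)
  from frechet_derivative_eqI[OF has_derivative_change_chart[OF cd this]] show ?thesis by simp
qed

text \<open>Change of chart applied to the function \<open>coord e\<close>, whose expression in a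
  chart is the transition map to \<open>e\<close>.\<close>

lemma transition_cocycle:
  assumes "c \<in> charts_at A p" "d \<in> charts_at A p" "e \<in> charts_at A p"
  shows "frechet_derivative (transition c e) (at (coord c p)) u
    = frechet_derivative (transition d e) (at (coord d p))
        (frechet_derivative (transition c d) (at (coord c p)) u)"
  using frechet_derivative_change_chart[OF assms(1,2), of "coord e" u]
    transition_has_derivative[OF assms(2,3)]
  by (auto simp: transition_def[symmetric] differentiable_def)

lemma transition_self:
  assumes "c \<in> charts_at A p"
  shows "frechet_derivative (transition c c) (at (coord c p)) u = u"
proof -
  have "(transition c c has_derivative (\<lambda>u. u)) (at (coord c p))"
    by (rule has_derivative_transform_within_open[OF has_derivative_ident open_chart_image[of c]])
      (use assms in \<open>auto simp: charts_at_iff transition_def coord_param coord_in_image\<close>)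
  then show ?thesis by (simp add: frechet_derivative_eqI)
qed

section \<open>Tangent spaces and coordinate vectors\<close>

lemma tangent_spaceI:
  assumes "\<And>c. c \<notin> charts_at A p \<Longrightarrow> v c = 0"
    and "\<And>c d. c \<in> charts_at A p \<Longrightarrow> d \<in> charts_at A p \<Longrightarrow>
      v d = frechet_derivative (transition c d) (at (coord c p)) (v c)"
  shows "v \<in> tangent_space A p"
  unfolding tangent_space_def using assms by blast

lemma tangent_space_vanishes: "v \<in> tangent_space A p \<Longrightarrow> c \<notin> charts_at A p \<Longrightarrow> v c = 0"
  unfolding tangent_space_def by blast

lemma tangent_space_transition:
  "v \<in> tangent_space A p \<Longrightarrow> c \<in> charts_at A p \<Longrightarrow> d \<in> charts_at A p \<Longrightarrow>
    frechet_derivative (transition c d) (at (coord c p)) (v c) = v d"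
  unfolding tangent_space_def by (metis (mono_tags, lifting) mem_Collect_eq)

text \<open>The compatibility demanded of a tangent vector is here exactly the cocycle identity of
  the transition differentials.\<close>

lemma coord_vec_tangent:
  assumes "c \<in> charts_at A p"
  shows "coord_vec A c u p \<in> tangent_space A p"
proof (rule tangent_spaceI)
  show "coord_vec A c u p d = 0" if "d \<notin> charts_at A p" for d
    using that by (simp add: coord_vec_def)
  show "coord_vec A c u p e = frechet_derivative (transition d e) (at (coord d p)) (coord_vec A c u p d)"
    if "d \<in> charts_at A p" "e \<in> charts_at A p" for d e
    using that by (simp only: coord_vec_def if_True transition_cocycle[OF assms that])
qed

lemma coord_vec_self: "c \<in> charts_at A p \<Longrightarrow> coord_vec A c u p c = u"
  by (simp add: coord_vec_def transition_self)

lemma coord_vec_component: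
  assumes "c \<in> charts_at A p" "v \<in> tangent_space A p"
  shows "coord_vec A c (v c) p = v"
  using assms by (intro ext) (simp add: coord_vec_def tangent_space_vanishes tangent_space_transition)

lemma transition_linear:
  "c \<in> charts_at A p \<Longrightarrow> d \<in> charts_at A p \<Longrightarrow>
    linear (frechet_derivative (transition c d) (at (coord c p)))"
  using has_derivative_linear[OF transition_has_derivative] by simp

lemma coord_vec_add:
  assumes "c \<in> charts_at A p"
  shows "coord_vec A c (u + v) p = coord_vec A c u p + coord_vec A c v p"
  by (intro ext) (simp add: coord_vec_def linear_add[OF transition_linear[OF assms]])

lemma coord_vec_scaleR:
  assumes "c \<in> charts_at A p"
  shows "coord_vec A c (r *\<^sub>R u) p = tscale r (coord_vec A c u p)"
  by (intro ext) (simp add: coord_vec_def tscale_def linear_cmul[OF transition_linear[OF assms]])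

lemma tangent_add: "u \<in> tangent_space A p \<Longrightarrow> v \<in> tangent_space A p \<Longrightarrow> u + v \<in> tangent_space A p"
  by (rule tangent_spaceI)
    (simp_all add: tangent_space_vanishes tangent_space_transition linear_add[OF transition_linear])

lemma tangent_tscale: "u \<in> tangent_space A p \<Longrightarrow> tscale r u \<in> tangent_space A p"
  by (rule tangent_spaceI)
    (simp_all add: tscale_def tangent_space_vanishes tangent_space_transition linear_cmul[OF transition_linear])

lemma tangent_zero: "0 \<in> tangent_space A p"
  by (rule tangent_spaceI) (simp_all add: linear_0[OF transition_linear])

lemma tangent_diff:
  assumes "u \<in> tangent_space A p" "v \<in> tangent_space A p"
  shows "u - v \<in> tangent_space A p"
proof -
  have "u - v = u + tscale (-1) v" by (intro ext) (simp add: tscale_def)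
  then show ?thesis by (simp only: tangent_add tangent_tscale assms)
qed

text \<open>By contraposition, a nonzero tangent vector supplies a chart around its base
  point.\<close>

lemma tangent_outside: "charts_at A p = {} \<Longrightarrow> v \<in> tangent_space A p \<Longrightarrow> v = 0"
  by (intro ext) (simp add: tangent_space_vanishes)

section \<open>Vector fields\<close>

lemma vector_field_tangent: "vector_field A X \<Longrightarrow> X p \<in> tangent_space A p"
  by (simp add: vector_field_def)

lemma vector_field_smooth:
  "vector_field A X \<Longrightarrow> c \<in> A \<Longrightarrow> smooth_on (chart_image c) (\<lambda>y. X (param c y) c)"
  by (simp add: vector_field_def)

lemma vector_field_add: "vector_field A X \<Longrightarrow> vector_field A Y \<Longrightarrow> vector_field A (X + Y)"
  by (auto simp: vector_field_def tangent_add intro!: smooth_on_add open_chart_image)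

lemma vector_field_diff: "vector_field A X \<Longrightarrow> vector_field A Y \<Longrightarrow> vector_field A (X - Y)"
  by (auto simp: vector_field_def tangent_diff intro!: smooth_on_diff open_chart_image)

lemma vector_field_zero: "vector_field A 0"
  by (simp add: vector_field_def tangent_zero smooth_on_const)

lemma smooth_function_const: "smooth_function A (\<lambda>p. r)"
  by (simp add: smooth_function_def o_def smooth_on_const)

lemma vector_field_fscale:
  "smooth_function A f \<Longrightarrow> vector_field A X \<Longrightarrow> vector_field A (fscale f X)"
  unfolding vector_field_def smooth_function_def o_def fscale_def
  by (auto intro: tangent_tscale) (simp add: tscale_def smooth_on_scaleR open_chart_image)

section \<open>Tensor fields in charts and on vector fields\<close>

lemma one_form_linear:
  assumes "one_form A \<omega>" "c \<in> charts_at A p"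
  shows "linear (\<lambda>u. \<omega> p (coord_vec A c u p))"
  using assms coord_vec_tangent[OF assms(2)]
  by (intro linearI) (auto simp: one_form_def coord_vec_add coord_vec_scaleR)

lemma endomorphism_linear:
  assumes "endomorphism_field A F" "c \<in> charts_at A p"
  shows "linear (\<lambda>u. F p (coord_vec A c u p) c)"
  using assms coord_vec_tangent[OF assms(2)]
  by (intro linearI) (auto simp: endomorphism_field_def coord_vec_add coord_vec_scaleR tscale_def)

text \<open>The definition of a metric gives linearity in the first slot; symmetry transfers it to
  the second.\<close>

lemma metric_bilinear:
  assumes "riemannian_metric A g" "c \<in> charts_at A p"
  shows "bilinear (\<lambda>u v. g p (coord_vec A c u p) (coord_vec A c v p))"
proof -
  have sym: "g p u v = g p v u" if "u \<in> tangent_space A p" "v \<in> tangent_space A p" for u v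
    using assms that by (simp add: riemannian_metric_def)
  have 1: "linear (\<lambda>u. g p (coord_vec A c u p) (coord_vec A c v p))" for v
    using assms coord_vec_tangent[OF assms(2)]
    by (intro linearI) (auto simp: riemannian_metric_def coord_vec_add coord_vec_scaleR)
  show ?thesis
    unfolding bilinear_def using 1 coord_vec_tangent[OF assms(2)] by (auto simp: sym)
qed

text \<open>This rewrites a field as the coordinate vector of its own component, the form in which
  \<open>linear_family_smooth\<close> evaluates tensors.\<close>

lemma component_param:
  assumes "vector_field A X" "c \<in> A" "y \<in> chart_image c"
  shows "coord_vec A c (X (param c y) c) (param c y) = X (param c y)"
  using assms by (intro coord_vec_component param_charts_at vector_field_tangent)

lemma smooth_one_form_apply:
  assumes "one_form A \<omega>" "vector_field A X"
  shows "smooth_function A (\<lambda>p. \<omega> p (X p))"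
  unfolding smooth_function_def
proof
  fix c assume c: "c \<in> A"
  have "smooth_on (chart_image c) (\<lambda>y. \<omega> (param c y) (coord_vec A c (X (param c y) c) (param c y)))"
  proof (rule linear_family_smooth[where L = "\<lambda>y u. \<omega> (param c y) (coord_vec A c u (param c y))"])
    show "smooth_on (chart_image c) (\<lambda>y. \<omega> (param c y) (coord_vec A c u (param c y)))" for u
      using assms c by (simp add: one_form_def)
  qed (use assms c in \<open>simp_all add: open_chart_image one_form_linear param_charts_at vector_field_smooth\<close>)
  then show "smooth_on (chart_image c) ((\<lambda>p. \<omega> p (X p)) \<circ> param c)"
    by (rule smooth_on_cong[OF open_chart_image[OF c], rotated])
      (simp add: component_param[OF assms(2) c])
qed

lemma vector_field_endo_apply:
  assumes "endomorphism_field A F" "vector_field A X"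
  shows "vector_field A (endo_apply F X)"
  unfolding vector_field_def
proof (intro conjI allI ballI)
  show "endo_apply F X p \<in> tangent_space A p" for p
    using assms by (simp add: endo_apply_def endomorphism_field_def vector_field_def)
  fix c assume c: "c \<in> A"
  have "smooth_on (chart_image c) (\<lambda>y. F (param c y) (coord_vec A c (X (param c y) c) (param c y)) c)"
  proof (rule linear_family_smooth[where L = "\<lambda>y u. F (param c y) (coord_vec A c u (param c y)) c"])
    show "smooth_on (chart_image c) (\<lambda>y. F (param c y) (coord_vec A c u (param c y)) c)" for u
      using assms c by (simp add: endomorphism_field_def)
  qed (use assms c in \<open>simp_all add: open_chart_image endomorphism_linear param_charts_at vector_field_smooth\<close>)
  then show "smooth_on (chart_image c) (\<lambda>y. endo_apply F X (param c y) c)"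
    by (rule smooth_on_cong[OF open_chart_image[OF c], rotated])
      (simp add: component_param[OF assms(2) c] endo_apply_def)
qed

text \<open>The fields are inserted one slot at a time: first \<open>Y\<close> with a constant first
  argument, then \<open>X\<close> into the resulting family of linear maps.\<close>

lemma smooth_metric_apply:
  assumes "riemannian_metric A g" "vector_field A X" "vector_field A Y"
  shows "smooth_function A (\<lambda>p. g p (X p) (Y p))"
  unfolding smooth_function_def
proof
  fix c assume c: "c \<in> A"
  let ?b = "\<lambda>y u v. g (param c y) (coord_vec A c u (param c y)) (coord_vec A c v (param c y))"
  have lin: "linear (\<lambda>u. ?b y u v)" "linear (?b y u)" if "y \<in> chart_image c" for y u v
    using metric_bilinear[OF assms(1) param_charts_at[OF c that]] by (auto simp: bilinear_def)
  have b: "smooth_on (chart_image c) (\<lambda>y. ?b y u v)" for u v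
    using assms(1) c by (simp add: riemannian_metric_def)
  have bY: "smooth_on (chart_image c) (\<lambda>y. ?b y u (Y (param c y) c))" for u
    by (rule linear_family_smooth[where L = "\<lambda>y v. ?b y u v",
          OF open_chart_image[OF c] lin(2) b vector_field_smooth[OF assms(3) c]])
  have "smooth_on (chart_image c) (\<lambda>y. ?b y (X (param c y) c) (Y (param c y) c))"
    by (rule linear_family_smooth[where L = "\<lambda>y u. ?b y u (Y (param c y) c)",
          OF open_chart_image[OF c] lin(1) bY vector_field_smooth[OF assms(2) c]])
  then show "smooth_on (chart_image c) ((\<lambda>p. g p (X p) (Y p)) \<circ> param c)"
    by (rule smooth_on_cong[OF open_chart_image[OF c], rotated])
      (simp add: component_param[OF assms(2) c] component_param[OF assms(3) c])
qed

text \<open>The derivative is defined by an arbitrarily chosen chart. Passing to \<open>c\<close>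
  transforms the differential of \<open>f\<close> and the component of \<open>X\<close> by the same
  transition differential, so the value is unaffected.\<close>

lemma vf_apply_chart:
  assumes c: "c \<in> charts_at A p" and X: "vector_field A X"
    and f: "(f \<circ> param c) differentiable (at (coord c p))"
  shows "vf_apply A X f p = frechet_derivative (f \<circ> param c) (at (coord c p)) (X p c)"
proof -
  define d where "d = (SOME d. d \<in> charts_at A p)"
  have d: "d \<in> charts_at A p" unfolding d_def using c by (rule someI)
  have "frechet_derivative (transition d c) (at (coord d p)) (X p d) = X p c"
    by (rule tangent_space_transition[OF vector_field_tangent[OF X] d c])
  then show ?thesis
    using frechet_derivative_change_chart[OF d c f, of "X p d"]
    by (simp add: vf_apply_def d_def[symmetric])
qed

text \<open>In the chart, X(Yf) is the second derivative of \<phi> =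
  \<open>f \<circ> param c\<close> in the directions Y and X plus the first derivative along DY(X).
  In the commutator the second derivatives cancel by symmetry, and DY(X) - DX(Y) is the
  bracket.\<close>

lemma vf_apply_lie_bracket:
  assumes f: "smooth_function A f" and X: "vector_field A X" and Y: "vector_field A Y"
    and XY: "vector_field A (lie_bracket A X Y)" and p: "c \<in> charts_at A p"
  shows "vf_apply A (lie_bracket A X Y) f p
    = vf_apply A X (vf_apply A Y f) p - vf_apply A Y (vf_apply A X f) p"
proof -
  have c: "c \<in> A" "p \<in> chart_dom c" using p by (simp_all add: charts_at_iff)
  let ?U = "chart_image c" and ?x = "coord c p" and ?\<phi> = "f \<circ> param c"
  note U = open_chart_image[OF c(1)] coord_in_image[OF c(2)]
  have \<phi>: "smooth_on ?U ?\<phi>" using f c by (simp add: smooth_function_def)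
  let ?comp = "\<lambda>X y. X (param c y) c"
  have lin: "linear (frechet_derivative ?\<phi> (at y))" if "y \<in> ?U" for y
    using has_derivative_linear[OF smooth_on_has_derivative[OF \<phi> that]] .
  let ?H = "\<lambda>v w. frechet_derivative (\<lambda>y. frechet_derivative ?\<phi> (at y) v) (at ?x) w"
  have second: "vf_apply A X (vf_apply A Y f) p
      = ?H (Y p c) (X p c)
        + frechet_derivative ?\<phi> (at ?x) (frechet_derivative (?comp Y) (at ?x) (X p c))"
    if X: "vector_field A X" and Y: "vector_field A Y" for X Y
  proof -
    \<comment> \<open>The product rule for evaluation, with the differential of \<phi> as the linear
      family and the component of \<open>Y\<close> as its argument.\<close>
    have "((\<lambda>y. frechet_derivative ?\<phi> (at y) (?comp Y y)) has_derivative
       (\<lambda>v. ?H (?comp Y ?x) v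
         + frechet_derivative ?\<phi> (at ?x) (frechet_derivative (?comp Y) (at ?x) v))) (at ?x)"
      using U vector_field_smooth[OF Y c(1)]
      by (intro linear_family_has_derivative[where S = ?U and L = "\<lambda>y. frechet_derivative ?\<phi> (at y)"]
          lin smooth_on_has_derivative[of ?U "?comp Y"]
          smooth_on_differentiable[OF smooth_on_frechet_derivative[OF \<phi>]])
    then have "((vf_apply A Y f \<circ> param c) has_derivative
       (\<lambda>v. ?H (?comp Y ?x) v
         + frechet_derivative ?\<phi> (at ?x) (frechet_derivative (?comp Y) (at ?x) v))) (at ?x)"
    proof (rule has_derivative_transform_within_open[OF _ U])
      fix y assume y: "y \<in> ?U"
      show "frechet_derivative ?\<phi> (at y) (?comp Y y) = (vf_apply A Y f \<circ> param c) y"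
        using vf_apply_chart[OF param_charts_at[OF c(1) y] Y, of f]
          smooth_on_differentiable[OF \<phi> y] y
        by (simp add: coord_param)
    qed
    then show ?thesis
      using vf_apply_chart[OF p X, of "vf_apply A Y f"] c
      by (auto simp: frechet_derivative_eqI param_coord differentiable_def)
  qed
  have "vf_apply A (lie_bracket A X Y) f p = frechet_derivative ?\<phi> (at ?x)
     (frechet_derivative (?comp Y) (at ?x) (X p c) - frechet_derivative (?comp X) (at ?x) (Y p c))"
    using vf_apply_chart[OF p XY, of f] smooth_on_differentiable[OF \<phi> U(2)] p
    by (simp add: lie_bracket_def)
  then show ?thesis
    unfolding second[OF X Y] second[OF Y X]
    using smooth_on_second_derivative_symmetric[OF \<phi> U, of "Y p c" "X p c"]
    by (simp add: linear_diff[OF lin[OF U(2)]])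
qed

section \<open>Curvature\<close>

text \<open>The relation between \<open>f\<close> and \<open>h\<close> is local: an iterated
  derivative such as V(g(Z,Z)) is given by a formula in the metric at points of the chart domain,
  which is enough to differentiate it once more.\<close>

lemma vf_apply_cong_scale:
  assumes c: "c \<in> charts_at A p" and X: "vector_field A X" and h: "smooth_function A h"
    and f: "\<And>q. q \<in> chart_dom c \<Longrightarrow> f q = r * h q"
  shows "vf_apply A X f p = r * vf_apply A X h p"
proof -
  have cA: "c \<in> A" and x: "coord c p \<in> chart_image c"
    using c by (simp_all add: charts_at_iff coord_in_image)
  have h': "((h \<circ> param c) has_derivative frechet_derivative (h \<circ> param c) (at (coord c p))) (at (coord c p))"
    by (rule smooth_on_has_derivative[OF _ x]) (use h cA in \<open>simp add: smooth_function_def\<close>)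
  have "((\<lambda>y. r * (h \<circ> param c) y) has_derivative
      (\<lambda>u. r * frechet_derivative (h \<circ> param c) (at (coord c p)) u)) (at (coord c p))"
    by (rule has_derivative_mult_right[OF h'])
  then have f': "((f \<circ> param c) has_derivative
      (\<lambda>u. r * frechet_derivative (h \<circ> param c) (at (coord c p)) u)) (at (coord c p))"
    by (rule has_derivative_transform_within_open[OF _ open_chart_image[OF cA] x])
      (simp add: f param_in_dom)
  show ?thesis
    unfolding vf_apply_chart[OF c X differentiableI[OF f']] vf_apply_chart[OF c X differentiableI[OF h']]
    by (simp only: frechet_derivative_eqI[OF f'])
qed

lemma metric_sym:
  "riemannian_metric A g \<Longrightarrow> u \<in> tangent_space A p \<Longrightarrow> v \<in> tangent_space A p \<Longrightarrow> g p u v = g p v u"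
  by (simp add: riemannian_metric_def)

lemma metric_scale:
  "riemannian_metric A g \<Longrightarrow> u \<in> tangent_space A p \<Longrightarrow> v \<in> tangent_space A p \<Longrightarrow>
    g p (tscale r u) v = r * g p u v"
  by (simp add: riemannian_metric_def)

lemma metric_diff:
  assumes g: "riemannian_metric A g"
    and u: "u \<in> tangent_space A p" and v: "v \<in> tangent_space A p" and w: "w \<in> tangent_space A p"
  shows "g p (u - v) w = g p u w - g p v w"
proof -
  have "g p ((u - v) + v) w = g p (u - v) w + g p v w"
    using g tangent_diff[OF u v] v w unfolding riemannian_metric_def by blast
  then show ?thesis by simp
qed

lemma metric_pos:
  "riemannian_metric A g \<Longrightarrow> u \<in> tangent_space A p \<Longrightarrow> u \<noteq> 0 \<Longrightarrow> g p u u > 0"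
  by (simp add: riemannian_metric_def)

lemma endo_apply_diff:
  assumes F: "endomorphism_field A F" and X: "vector_field A X" and Y: "vector_field A Y"
  shows "endo_apply F (X - Y) = endo_apply F X - endo_apply F Y"
proof
  fix p
  have "F p ((X p - Y p) + Y p) = F p (X p - Y p) + F p (Y p)"
    using F tangent_diff[OF vector_field_tangent[OF X] vector_field_tangent[OF Y]]
      vector_field_tangent[OF Y]
    unfolding endomorphism_field_def by blast
  then show "endo_apply F (X - Y) p = (endo_apply F X - endo_apply F Y) p"
    by (simp add: endo_apply_def)
qed

section \<open>Smoothness of covariant derivatives, brackets and curvature\<close>

lemma vector_field_nabla:
  "affine_connection A nabla \<Longrightarrow> vector_field A X \<Longrightarrow> vector_field A Y \<Longrightarrow> vector_field A (nabla X Y)"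
  by (simp add: affine_connection_def)

text \<open>Vanishing torsion expresses the bracket through covariant derivatives, which are vector
  fields; its transformation law need not be computed in charts.\<close>

lemma vector_field_lie_bracket:
  assumes "levi_civita A g nabla" "vector_field A X" "vector_field A Y"
  shows "vector_field A (lie_bracket A X Y)"
proof -
  have "affine_connection A nabla" "lie_bracket A X Y = nabla X Y - nabla Y X"
    using assms by (simp_all add: levi_civita_def)
  then show ?thesis using assms by (simp add: vector_field_diff vector_field_nabla)
qed

lemma vector_field_curvature:
  assumes "levi_civita A g nabla" "vector_field A X" "vector_field A Y" "vector_field A Z"
  shows "vector_field A (curvature A nabla X Y Z)"
proof -
  have conn: "affine_connection A nabla" using assms(1) by (simp add: levi_civita_def)
  show ?thesis
    unfolding curvature_def
    by (simp add: vector_field_diff vector_field_nabla[OF conn] vector_field_lie_bracket[OF assms(1-3)]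
        assms(2-4))
qed

text \<open>For f = g(Z,Z), metric compatibility gives Uf = 2 g(\<nabla>_U Z, Z). Substituting into
  [X,Y]f = X(Yf) - Y(Xf), the terms g(\<nabla>_X Z, \<nabla>_Y Z) cancel by symmetry of g, and what
  remains is 2 g(R(X,Y)Z, Z) = 0.\<close>

lemma curvature_skew:
  assumes g: "riemannian_metric A g" and LC: "levi_civita A g nabla"
    and X: "vector_field A X" and Y: "vector_field A Y" and Z: "vector_field A Z"
    and c: "c \<in> charts_at A p"
  shows "g p (curvature A nabla X Y Z p) (Z p) = 0"
proof -
  have conn: "affine_connection A nabla" using LC by (simp add: levi_civita_def)
  note N = vector_field_nabla[OF conn] and T = vector_field_tangent
  have compat: "vf_apply A U (\<lambda>q. g q (V q) (W q)) q = g q (nabla U V q) (W q) + g q (V q) (nabla U W q)"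
    if "vector_field A U" "vector_field A V" "vector_field A W" "q \<in> chart_dom c" for U V W q
    using LC that c unfolding levi_civita_def charts_at_iff by blast
  have p: "p \<in> chart_dom c" using c by (simp add: charts_at_iff)
  define f where "f = (\<lambda>q. g q (Z q) (Z q))"
  have Df: "vf_apply A U f q = 2 * g q (nabla U Z q) (Z q)"
    if "vector_field A U" "q \<in> chart_dom c" for U q
    unfolding f_def compat[OF that(1) Z Z that(2)]
    using metric_sym[OF g T[OF Z] T[OF N[OF that(1) Z]]] by simp
  have DDf: "vf_apply A U (vf_apply A V f) p
      = 2 * (g p (nabla U (nabla V Z) p) (Z p) + g p (nabla V Z p) (nabla U Z p))"
    if U: "vector_field A U" and V: "vector_field A V" for U V
    using vf_apply_cong_scale[OF c U smooth_metric_apply[OF g N[OF V Z] Z], of "vf_apply A V f" 2]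
      Df[OF V] compat[OF U N[OF V Z] Z p] by simp
  note XY = vector_field_lie_bracket[OF LC X Y]
  have "vf_apply A (lie_bracket A X Y) f p = vf_apply A X (vf_apply A Y f) p - vf_apply A Y (vf_apply A X f) p"
    using vf_apply_lie_bracket[OF smooth_metric_apply[OF g Z Z] X Y XY c] by (simp add: f_def)
  then have "g p (nabla (lie_bracket A X Y) Z p) (Z p)
     = g p (nabla X (nabla Y Z) p) (Z p) - g p (nabla Y (nabla X Z) p) (Z p)"
    using metric_sym[OF g T[OF N[OF X Z]] T[OF N[OF Y Z]], of p]
    by (simp add: Df[OF XY p] DDf[OF X Y] DDf[OF Y X])
  then show ?thesis
    by (simp add: curvature_def metric_diff[OF g] tangent_diff T Z N X Y XY)
qed

text \<open>The scalar factor is d\<omega>(X,Y). Recurrence reads \<nabla>_U(FV) = F(\<nabla>_U V) +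
  \<omega>(U) FV. After differentiating twice, the terms with one \<omega> and \<nabla>Z, and the
  one with \<omega>(X)\<omega>(Y), are symmetric in X and Y and drop out of the commutator.\<close>

lemma curvature_recurrent_commutator:
  assumes LC: "levi_civita A g nabla" and F: "endomorphism_field A F" and \<omega>: "one_form A \<omega>"
    and rec: "\<And>X Y. vector_field A X \<Longrightarrow> vector_field A Y \<Longrightarrow>
      covariant_derivative_endo nabla F X Y = fscale (\<lambda>p. \<omega> p (X p)) (endo_apply F Y)"
    and X: "vector_field A X" and Y: "vector_field A Y" and Z: "vector_field A Z"
  shows "curvature A nabla X Y (endo_apply F Z) - endo_apply F (curvature A nabla X Y Z)
    = fscale (\<lambda>p. vf_apply A X (\<lambda>q. \<omega> q (Y q)) p - vf_apply A Y (\<lambda>q. \<omega> q (X q)) p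
        - \<omega> p (lie_bracket A X Y p)) (endo_apply F Z)"
proof -
  have conn: "affine_connection A nabla" using LC by (simp add: levi_civita_def)
  note N = vector_field_nabla[OF conn] and FV = vector_field_endo_apply[OF F]
    and XY = vector_field_lie_bracket[OF LC X Y]
  define om where "om X = (\<lambda>p. \<omega> p (X p))" for X
  have om: "smooth_function A (om U)" if "vector_field A U" for U
    unfolding om_def by (rule smooth_one_form_apply[OF \<omega> that])
  have first: "nabla U (endo_apply F V) = endo_apply F (nabla U V) + fscale (om U) (endo_apply F V)"
    if "vector_field A U" "vector_field A V" for U V
    using rec[OF that] unfolding covariant_derivative_endo_def om_def by (metis add.commute diff_eq_eq)
  have nabla_add: "nabla U (V + W) = nabla U V + nabla U W"
    if "vector_field A U" "vector_field A V" "vector_field A W" for U V W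
    using conn that unfolding affine_connection_def by blast
  have leibniz: "nabla U (fscale h V) = fscale (vf_apply A U h) V + fscale h (nabla U V)"
    if "vector_field A U" "vector_field A V" "smooth_function A h" for U V h
    using conn that unfolding affine_connection_def by blast
  have second: "nabla U (nabla V (endo_apply F Z)) = endo_apply F (nabla U (nabla V Z))
      + fscale (om U) (endo_apply F (nabla V Z)) + (fscale (vf_apply A U (om V)) (endo_apply F Z)
      + fscale (om V) (endo_apply F (nabla U Z) + fscale (om U) (endo_apply F Z)))"
    if U: "vector_field A U" and V: "vector_field A V" for U V
    unfolding first[OF V Z]
      nabla_add[OF U FV[OF N[OF V Z]] vector_field_fscale[OF om[OF V] FV[OF Z]]]
      leibniz[OF U FV[OF Z] om[OF V]] first[OF U N[OF V Z]] first[OF U Z] ..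
  have F_curv: "endo_apply F (curvature A nabla X Y Z) = endo_apply F (nabla X (nabla Y Z))
      - endo_apply F (nabla Y (nabla X Z)) - endo_apply F (nabla (lie_bracket A X Y) Z)"
    unfolding curvature_def
    by (simp add: endo_apply_diff[OF F] vector_field_diff N X Y Z XY)
  show ?thesis
    unfolding F_curv unfolding curvature_def second[OF X Y] second[OF Y X] first[OF XY Z]
      om_def[symmetric]
    by (intro ext) (simp add: fscale_def tscale_def om_def algebra_simps)
qed

text \<open>Tangent vectors form a function type without a Euclidean structure, so the problem is
  moved to the model space by a chart at \<open>p\<close>: \<open>i\<close> turns components into
  tangent vectors, and \<open>b\<close> and \<open>B\<close> represent metric and
  endomorphism.\<close>

lemma symmetric_endomorphism_square_eigenvector:
  assumes g: "riemannian_metric A g" and F: "endomorphism_field A F"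
    and sym: "symmetric_endomorphism A g F" and Z: "vector_field A Z" "F p (Z p) \<noteq> 0"
  obtains W \<mu> where "vector_field A W" "W p \<noteq> 0" "\<mu> > 0" "F p (F p (W p)) = tscale \<mu> (W p)"
proof -
  have FT: "F p v \<in> tangent_space A p" if "v \<in> tangent_space A p" for v
    using F that by (simp add: endomorphism_field_def)
  note T = vector_field_tangent
  obtain c where c: "c \<in> charts_at A p"
    using tangent_outside[OF _ FT[OF T[OF Z(1)]]] Z(2) by blast
  define i where "i u = coord_vec A c u p" for u
  define b where "b u v = g p (i u) (i v)" for u v
  define B where "B u = F p (i u) c" for u
  have iT: "i u \<in> tangent_space A p" for u
    unfolding i_def by (rule coord_vec_tangent[OF c])
  have i_comp: "i (v c) = v" if "v \<in> tangent_space A p" for v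
    unfolding i_def by (rule coord_vec_component[OF c that])
  have iB: "i (B u) = F p (i u)" for u
    unfolding B_def by (rule i_comp[OF FT[OF iT]])
  have i_self: "i u c = u" for u unfolding i_def by (rule coord_vec_self[OF c])
  define V where "V = {W p c | W. vector_field A W}"
  have "subspace V"
    unfolding subspace_def
  proof (intro conjI ballI allI)
    show "0 \<in> V" unfolding V_def using vector_field_zero by (auto intro!: exI[of _ 0])
    show "x + y \<in> V" if "x \<in> V" "y \<in> V" for x y
      using that vector_field_add unfolding V_def by (force simp: plus_fun_def)
    show "r *\<^sub>R x \<in> V" if x: "x \<in> V" for r x
    proof -
      obtain W where "vector_field A W" "x = W p c" using x by (auto simp: V_def)
      then show ?thesis
        unfolding V_def
        using vector_field_fscale[OF smooth_function_const[of r], of W]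
        by (auto simp: fscale_def tscale_def intro!: exI[of _ "fscale (\<lambda>p. r) W"])
    qed
  qed
  moreover have "B u \<in> V" if u: "u \<in> V" for u
  proof -
    obtain W where W: "vector_field A W" "u = W p c" using u by (auto simp: V_def)
    then have "B u = endo_apply F W p c" by (simp add: B_def i_comp[OF T] endo_apply_def)
    then show ?thesis unfolding V_def using vector_field_endo_apply[OF F W(1)] by blast
  qed
  moreover have "bilinear b"
    unfolding b_def i_def by (rule metric_bilinear[OF g c])
  moreover have "b u v = b v u" for u v
    unfolding b_def by (rule metric_sym[OF g iT iT])
  moreover have "b u u > 0" if "u \<noteq> 0" for u
    unfolding b_def using i_self[of u] that by (intro metric_pos[OF g iT]) auto
  moreover have "linear B"
    unfolding B_def i_def by (rule endomorphism_linear[OF F c])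
  moreover have "b (B u) v = b u (B v)" for u v
    using sym iT by (simp add: b_def iB symmetric_endomorphism_def)
  moreover have "Z p c \<in> V" using Z by (auto simp: V_def)
  moreover have "B (Z p c) \<noteq> 0"
  proof
    assume "B (Z p c) = 0"
    \<comment> \<open>The form \<open>0 *\<^sub>R 0\<close> lets \<open>coord_vec_scaleR\<close>
      show that \<open>i\<close> sends zero to zero.\<close>
    then have "i (0 *\<^sub>R 0) = F p (Z p)" using iB[of "Z p c"] i_comp[OF T[OF Z(1)]] by simp
    then show False
      using Z(2) coord_vec_scaleR[OF c, of 0 0] by (simp add: i_def tscale_def fun_eq_iff)
  qed
  ultimately obtain z \<mu> where z: "z \<in> V" "z \<noteq> 0" "\<mu> > 0" "B (B z) = \<mu> *\<^sub>R z"
    using self_adjoint_square_eigenvector[of b B V "Z p c"] by metis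
  obtain W where W: "vector_field A W" "z = W p c" using z(1) by (auto simp: V_def)
  have iz: "i z = W p" using W i_comp[OF T] by simp
  have "F p (F p (W p)) = i (\<mu> *\<^sub>R z)" using iB[of "B z"] iB[of z] z(4) iz by simp
  also have "\<dots> = tscale \<mu> (W p)" using coord_vec_scaleR[OF c, of \<mu> z] iz by (simp add: i_def)
  finally have "F p (F p (W p)) = tscale \<mu> (W p)" .
  moreover have "W p \<noteq> 0" using W(2) z(2) by (metis zero_fun_def)
  ultimately show ?thesis using that W(1) z(3) by blast
qed

lemma recurrent_symmetric_semi_parallel:
  assumes g: "riemannian_metric A g" and LC: "levi_civita A g nabla"
    and F: "endomorphism_field A F" and sym: "symmetric_endomorphism A g F"
    and rec: "recurrent A nabla F"
  shows "semi_parallel A nabla F"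
  unfolding semi_parallel_def
proof (intro allI impI ext)
  fix X Y Z p
  assume X: "vector_field A X" and Y: "vector_field A Y" and Z: "vector_field A Z"
  from rec obtain \<omega> where \<omega>: "one_form A \<omega>" and rec': "\<And>X Y. vector_field A X \<Longrightarrow> vector_field A Y \<Longrightarrow>
      covariant_derivative_endo nabla F X Y = fscale (\<lambda>p. \<omega> p (X p)) (endo_apply F Y)"
    unfolding recurrent_def by blast
  define d where "d = (\<lambda>p. vf_apply A X (\<lambda>q. \<omega> q (Y q)) p - vf_apply A Y (\<lambda>q. \<omega> q (X q)) p
        - \<omega> p (lie_bracket A X Y p))"
  have comm: "curvature A nabla X Y (endo_apply F V) - endo_apply F (curvature A nabla X Y V)
      = fscale d (endo_apply F V)" if "vector_field A V" for V
    unfolding d_def by (rule curvature_recurrent_commutator[OF LC F \<omega> _ X Y that]) (rule rec')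
  note T = vector_field_tangent and FV = vector_field_endo_apply[OF F]
    and R = vector_field_curvature[OF LC X Y]
  have FT: "F p v \<in> tangent_space A p" if "v \<in> tangent_space A p" for v
    using F that by (simp add: endomorphism_field_def)
  have "tscale (d p) (F p (Z p)) = 0"
  \<comment> \<open>In the nontrivial case \<open>Z\<close> itself is the global field on which the
    endomorphism is nonzero at \<open>p\<close>, as the eigenvector lemma requires.\<close>
  proof (cases "F p (Z p) = 0")
    case True
    then show ?thesis by (simp add: tscale_def fun_eq_iff)
  next
    case False
    obtain c where c: "c \<in> charts_at A p"
      using tangent_outside[OF _ FT[OF T[OF Z]]] False by blast
    obtain W \<mu> where W: "vector_field A W" "W p \<noteq> 0" "\<mu> > 0" and FF: "F p (F p (W p)) = tscale \<mu> (W p)"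
      using symmetric_endomorphism_square_eigenvector[OF g F sym Z False] by blast
    \<comment> \<open>Moving one F across the metric makes F^2 act on the eigenvector, so pairing
      with FW after F becomes \<mu> times pairing with W.\<close>
    have adj: "g p (F p u) (F p (W p)) = \<mu> * g p u (W p)" if "u \<in> tangent_space A p" for u
    proof -
      have "g p (F p u) (F p (W p)) = g p u (tscale \<mu> (W p))"
        using sym that FT[OF T[OF W(1)]] by (simp add: symmetric_endomorphism_def flip: FF)
      then show ?thesis
        using metric_sym[OF g that] metric_scale[OF g T[OF W(1)] that]
          tangent_tscale T[OF W(1)] by simp
    qed
    have "d p * g p (F p (W p)) (F p (W p)) = g p (tscale (d p) (F p (W p))) (F p (W p))"
      using metric_scale[OF g] FT[OF T[OF W(1)]] by simp
    also have "tscale (d p) (F p (W p))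
        = curvature A nabla X Y (endo_apply F W) p - F p (curvature A nabla X Y W p)"
      using fun_cong[OF comm[OF W(1)], of p] by (simp add: fscale_def endo_apply_def)
    also have "g p \<dots> (F p (W p)) = g p (curvature A nabla X Y (endo_apply F W) p) (F p (W p))
        - g p (F p (curvature A nabla X Y W p)) (F p (W p))"
      by (intro metric_diff[OF g] FT T R FV W)
    \<comment> \<open>The first term vanishes by skewness of the curvature at FW. By
      \<open>adj\<close> the second is \<mu> g(R(X,Y)W, W), which vanishes by skewness at W.\<close>
    also have "\<dots> = 0"
      using curvature_skew[OF g LC X Y FV[OF W(1)] c] curvature_skew[OF g LC X Y W(1) c]
        adj[OF T[OF R[OF W(1)]]] by (simp add: endo_apply_def)
    finally have "d p * g p (F p (W p)) (F p (W p)) = 0" .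
    \<comment> \<open>By \<open>adj\<close> this equals \<mu> g(W,W), with \<mu> > 0 and W nonzero
      at \<open>p\<close>; hence the factor \<open>d p\<close> must vanish.\<close>
    moreover have "g p (F p (W p)) (F p (W p)) > 0"
      using adj[OF T[OF W(1)]] W metric_pos[OF g T[OF W(1)]] by simp
    ultimately show ?thesis by (simp add: tscale_def fun_eq_iff)
  qed
  then show "(curvature A nabla X Y (endo_apply F Z) - endo_apply F (curvature A nabla X Y Z)) p c = 0 p c" for c
    using comm[OF Z] by (simp add: fscale_def endo_apply_def)
qed

end

theorem theorem20:
  fixes M :: "'a topology"
    and A :: "('a, 'e::euclidean_space) chart set"
    and g :: "'a \<Rightarrow> ('a, 'e) tvec \<Rightarrow> ('a, 'e) tvec \<Rightarrow> real"
    and nabla :: "('a, 'e) connection"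
    and F :: "'a \<Rightarrow> ('a, 'e) tvec \<Rightarrow> ('a, 'e) tvec"
  assumes "riemannian_manifold M A g"
    and "connected_space M"
    and "levi_civita A g nabla"
    and "endomorphism_field A F"
    and "symmetric_endomorphism A g F"
    and "recurrent A nabla F"
  shows "semi_parallel A nabla F"
proof -
  interpret atlas M A
    using assms(1) by unfold_locales (simp add: riemannian_manifold_def)
  show ?thesis
    using assms by (intro recurrent_symmetric_semi_parallel[of g]) (simp_all add: riemannian_manifold_def)
qed

end
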